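(* Let $\mathcal X$ be a Polish space and $\mu\in\mathcal P(\mathcal X)$. Let $\mathcal F$ be a vector space of measurable functions $\mathcal X\to\mathbb R$ such that $\int_{\mathcal X}e^{\varphi}\,d\mu<\infty$ for all $\varphi\in\mathcal F$, and let $\Phi$ be a set of couples $(\psi,\varphi)$ with $(0,0)\in\Phi\subset\mathcal F\times\mathcal F$. Let $\alpha$ be any function in $\mathcal C$. Consider the statements: (a) $\alpha(\mathcal T(\nu))\le H(\nu\mid\mu)$ for all $\nu\in\mathcal P_{\mathcal F}$; (b) $\Lambda_{\psi,\varphi}(s)\le\alpha^{\circledast}(s)$ for all $s\ge 0$ and all $(\psi,\varphi)\in\Phi$; (c) $\alpha(t)\le\Lambda_{\psi,\varphi}^*(t)$ for all $t\ge0$ and all $(\psi,\varphi)\in\Phi$; (d) $\limsup_{n\to\infty}\frac1n\log\mathbb P\big(\langle\varphi,L_n\rangle+\langle\psi,\mu\rangle\ge t\big)\le-\alpha(t)$ for all $t\ge0$ and all $(\psi,\varphi)\in\Phi$; (e) for all $n\ge1$, $\frac1n\log\mathbb P\big(\langle\varphi,L_n\rangle+\langle\psi,\mu\rangle\ge t\big)\le-\alpha(t)$ for all $t\ge0$ and all $(\psi,\varphi)\in\Phi$. Then (a)$\Leftrightarrow$(b)$\Leftrightarrow$(c), and (e)$\Rightarrow$(d)$\Rightarrow$(a). If in addition $\int_{\mathcal X}(\varphi+\psi)\,d\mu\le0$ for all $(\psi,\varphi)\in\Phi$, then (a)$\Leftrightarrow$(b)$\Leftrightarrow$(c)$\Le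ftrightarrow$(d)$\Leftrightarrow$(e).
   Context: $\mathcal P(\mathcal X)$ is the set of Borel probability measures on $\mathcal X$; $\langle\varphi,\nu\rangle=\int\varphi\,d\nu$. $H(\nu\mid\mu)=\int\log\frac{d\nu}{d\mu}\,d\nu$ if $\nu\ll\mu$ and $+\infty$ otherwise. $\mathcal P_{\mathcal F}=\{\nu\in\mathcal P(\mathcal X):\int|\varphi|\,d\nu<\infty\ \forall\varphi\in\mathcal F\}$. For $\nu\in\mathcal P_{\mathcal F}$, $\mathcal T(\nu)=\sup_{(\psi,\varphi)\in\Phi}\{\int\psi\,d\mu+\int\varphi\,d\nu\}\in[0,\infty]$. $L_n=\frac1n\sum_{i=1}^n\delta_{X_i}$, where $(X_i)_{i\ge1}$ is an i.i.d. sequence with law $\mu$. $\mathcal C$ is the class of all functions $\alpha$ on $[0,\infty)$ with values in $[0,\infty]$ that are convex, increasing (meaning nondecreasing), left continuous, with $\alpha(0)=0$; one sets $\alpha(+\infty)=\lim_{t\to\infty}\alpha(t)$. The monotone conjugate is $\alpha^{\circledast}(s)=\sup_{t\ge0}\{st-\alpha(t)\}$, $s\ge0$. $\Lambda_{\psi,\varphi}(s)=\log\int_{\mathcal X}\exp[s(\varphi(x)+\langle\psi,\mu\rangle)]\,\mu(dx)$, $s\in\mathbb R$, and $\Lambda_{\psi,\varphi}^*(t)=\sup_{s\in\mathbb R}\{st-\Lambda_{\psi,\varphi}(s)\}$, $t\in\mathbb R$. *)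

theory Defs
  imports "HOL-Probability.Probability"
begin

definition borel_prob_measures :: "'a::topological_space measure set" where
  "borel_prob_measures = {\<nu>. prob_space \<nu> \<and> sets \<nu> = sets borel}"

definition function_space :: "('a \<Rightarrow> real) set \<Rightarrow> bool" where
  "function_space F \<longleftrightarrow>
     (\<lambda>_. 0) \<in> F \<and>
     (\<forall>f\<in>F. \<forall>g\<in>F. (\<lambda>x. f x + g x) \<in> F) \<and>
     (\<forall>c. \<forall>f\<in>F. (\<lambda>x. c * f x) \<in> F)"

definition prob_measures_integrating ::
    "('a::topological_space \<Rightarrow> real) set \<Rightarrow> 'a measure set" where
  "prob_measures_integrating F = {\<nu>\<in>borel_prob_measures. \<forall>\<phi>\<in>F. integrable \<nu> \<phi>}"

text \<open>
  The integral of a real function with value in the extended reals, as the difference of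
  the integrals of the positive and the negative part; the Bochner integral would give 0
  to a function that is not integrable. It is only used where the integral of the negative
  part is finite.
\<close>

definition ext_integral :: "'a measure \<Rightarrow> ('a \<Rightarrow> real) \<Rightarrow> ereal" where
  "ext_integral M f =
     enn2ereal (\<integral>\<^sup>+x. ennreal (f x) \<partial>M) - enn2ereal (\<integral>\<^sup>+x. ennreal (- f x) \<partial>M)"

text \<open>
  Read \<open>relative_entropy \<nu> \<mu>\<close> as H(\<nu> | \<mu>). The argument order of \<^const>\<open>absolutely_continuous\<close>
  and \<^const>\<open>RN_deriv\<close> is the reverse one. The Radon-Nikodym derivative takes the values 0
  and \<open>\<infinity>\<close> only on a \<open>\<nu>\<close>-null set, so the conventions of \<^const>\<open>ln\<close> and \<^const>\<open>enn2real\<close>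
  there do not matter.
\<close>

definition relative_entropy :: "'a measure \<Rightarrow> 'a measure \<Rightarrow> ereal" where
  "relative_entropy \<nu> \<mu> =
     (if absolutely_continuous \<mu> \<nu>
      then ext_integral \<nu> (\<lambda>x. ln (enn2real (RN_deriv \<mu> \<nu> x)))
      else \<infinity>)"

definition transport_cost ::
    "'a measure \<Rightarrow> (('a \<Rightarrow> real) \<times> ('a \<Rightarrow> real)) set \<Rightarrow> 'a measure \<Rightarrow> ereal" where
  "transport_cost \<mu> \<Phi> \<nu> = (SUP (\<psi>, \<phi>)\<in>\<Phi>. ereal ((\<integral>x. \<psi> x \<partial>\<mu>) + (\<integral>x. \<phi> x \<partial>\<nu>)))"

text \<open>
  A function on \<open>[0, \<infinity>)\<close> with values in \<open>[0, \<infinity>]\<close> is represented by a function of type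
  \<^typ>\<open>real \<Rightarrow> ereal\<close> whose values at negative arguments are irrelevant. The convexity
  inequality relies on the convention \<open>0 * \<infinity> = 0\<close> of \<^typ>\<open>ereal\<close>.
\<close>

definition cost_class :: "(real \<Rightarrow> ereal) set" where
  "cost_class = {\<alpha>.
     (\<forall>t\<ge>0. 0 \<le> \<alpha> t) \<and>
     (\<forall>x\<ge>0. \<forall>y\<ge>0. \<forall>u\<in>{0..1}.
        \<alpha> ((1 - u) * x + u * y) \<le> ereal (1 - u) * \<alpha> x + ereal u * \<alpha> y) \<and>
     mono_on {0..} \<alpha> \<and>
     (\<forall>t>0. continuous (at_left t) \<alpha>) \<and>
     \<alpha> 0 = 0}"

definition extend_at_infinity :: "(real \<Rightarrow> ereal) \<Rightarrow> ereal \<Rightarrow> ereal" where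
  "extend_at_infinity \<alpha> t = (if t = \<infinity> then Lim at_top \<alpha> else \<alpha> (real_of_ereal t))"

definition monotone_conjugate :: "(real \<Rightarrow> ereal) \<Rightarrow> real \<Rightarrow> ereal" where
  "monotone_conjugate \<alpha> s = (SUP t\<in>{0..}. ereal (s * t) - \<alpha> t)"

definition log_laplace :: "'a measure \<Rightarrow> ('a \<Rightarrow> real) \<Rightarrow> ('a \<Rightarrow> real) \<Rightarrow> real \<Rightarrow> real" where
  "log_laplace \<mu> \<psi> \<phi> s = ln (\<integral>x. exp (s * (\<phi> x + (\<integral>y. \<psi> y \<partial>\<mu>))) \<partial>\<mu>)"

definition log_laplace_conjugate ::
    "'a measure \<Rightarrow> ('a \<Rightarrow> real) \<Rightarrow> ('a \<Rightarrow> real) \<Rightarrow> real \<Rightarrow> ereal" where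
  "log_laplace_conjugate \<mu> \<psi> \<phi> t = (SUP s. ereal (s * t - log_laplace \<mu> \<psi> \<phi> s))"

definition empirical_measure ::
    "(nat \<Rightarrow> 'b \<Rightarrow> 'a::topological_space) \<Rightarrow> nat \<Rightarrow> 'b \<Rightarrow> 'a measure" where
  "empirical_measure X n \<omega> =
     measure_of UNIV (sets borel)
       (\<lambda>A. ennreal (1 / real n) * (\<Sum>i=1..n. emeasure (return borel (X i \<omega>)) A))"

definition ext_ln :: "real \<Rightarrow> ereal" where
  "ext_ln p = (if p = 0 then -\<infinity> else ereal (ln p))"

definition deviation_rate ::
    "'b measure \<Rightarrow> (nat \<Rightarrow> 'b \<Rightarrow> 'a::topological_space) \<Rightarrow> 'a measure
      \<Rightarrow> ('a \<Rightarrow> real) \<Rightarrow> ('a \<Rightarrow> real) \<Rightarrow> real \<Rightarrow> nat \<Rightarrow> ereal" where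
  "deviation_rate P X \<mu> \<psi> \<phi> t n =
     ereal (1 / real n) *
     ext_ln (measure P {\<omega> \<in> space P.
       (\<integral>x. \<phi> x \<partial>empirical_measure X n \<omega>) + (\<integral>x. \<psi> x \<partial>\<mu>) \<ge> t})"

end

theory Submission
  imports Defs
begin

text \<open>
  Everything passes through statement (b), the comparison of \<open>\<Lambda> = log_laplace \<mu> \<psi> \<phi>\<close> with the
  monotone conjugate of \<open>\<alpha>\<close> on the half-line \<open>s \<ge> 0\<close>, because both entropy and large deviations
  speak about \<open>\<Lambda>\<close>.

  On the side of entropy, the Donsker--Varadhan formula says that
  \<open>s * (\<integral>\<psi> d\<mu> + \<integral>\<phi> d\<nu>) - \<Lambda> s \<le> H(\<nu>|\<mu>)\<close> for every \<open>\<nu>\<close>, with equality when \<open>\<nu>\<close> is the Gibbs measure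
  with density proportional to \<open>exp (s * \<phi>)\<close> (\<open>entropy_duality_le\<close>, \<open>entropy_duality_attained\<close>).
  Under (b) the left-hand side dominates \<open>s * t - \<alpha>\<^sup>\<circledast> s\<close>, where \<open>t = \<integral>\<psi> d\<mu> + \<integral>\<phi> d\<nu>\<close>; as \<open>\<alpha>\<close> is its own
  monotone biconjugate (\<open>monotone_biconjugate\<close>), taking the supremum over \<open>s \<ge> 0\<close> gives
  \<open>\<alpha> t \<le> H(\<nu>|\<mu>)\<close>, and the left continuity of \<open>\<alpha>\<close> carries the bound over to the supremum of all such \<open>t\<close>,
  which is (a). The same supremum without any \<open>\<nu>\<close> gives (c). Conversely, the Gibbs measure at \<open>s\<close>
  turns an entropy bound \<open>\<alpha> t \<le> H(\<nu>|\<mu>)\<close> into \<open>\<Lambda> s \<le> s * t - \<alpha> t \<le> \<alpha>\<^sup>\<circledast> s\<close>. Both (a) and (c) supply that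
  bound, (c) because \<open>\<Lambda>\<^sup>* t \<le> H(\<nu>|\<mu>)\<close>, again by Donsker--Varadhan.

  On the side of large deviations, (b) gives (e) by the Chernoff bound, optimised over \<open>s \<ge> 0\<close>
  with the help of the biconjugate. Trivially (e) gives (d). For (d) to (b), the expectation of
  \<open>exp (n * s * Y)\<close>, where \<open>Y\<close> is the sample mean of \<open>\<phi> + \<integral>\<psi> d\<mu>\<close>, is exactly \<open>exp (n * \<Lambda> s)\<close>, and it can be bounded from the tail
  probabilities of \<open>Y\<close> as in Laplace's principle: on a finite grid the tails at \<open>t\<close> contribute at
  most about \<open>exp (n * (s * t - \<alpha> t)) \<le> exp (n * \<alpha>\<^sup>\<circledast> s)\<close>, the values \<open>Y \<le> 0\<close> at most \<open>1\<close>, and the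
  values beyond the grid are negligible because \<open>\<Lambda> (s + 1)\<close> is finite. Letting \<open>n\<close> tend to infinity
  leaves \<open>\<Lambda> s \<le> \<alpha>\<^sup>\<circledast> s\<close> (\<open>log_laplace_le_if_limsup_le\<close>). This avoids Cramer's lower bound and any
  change of measure on the product space.
\<close>

section \<open>Cost functions and their monotone conjugates\<close>

lemma cost_class_nonneg: "\<alpha> \<in> cost_class \<Longrightarrow> 0 \<le> t \<Longrightarrow> 0 \<le> \<alpha> t"
  by (simp add: cost_class_def)

lemma cost_class_zero: "\<alpha> \<in> cost_class \<Longrightarrow> \<alpha> 0 = 0"
  by (simp add: cost_class_def)

lemma cost_class_mono: "\<alpha> \<in> cost_class \<Longrightarrow> 0 \<le> t \<Longrightarrow> t \<le> u \<Longrightarrow> \<alpha> t \<le> \<alpha> u"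
  by (auto simp: cost_class_def mono_on_def)

lemma cost_class_left_continuous:
  "\<alpha> \<in> cost_class \<Longrightarrow> 0 < t \<Longrightarrow> (\<alpha> \<longlongrightarrow> \<alpha> t) (at_left t)"
  by (simp add: cost_class_def continuous_within)

text \<open>
  If the graph of a convex function meets or passes below a line on both sides of a point, then it
  does so at the point itself. This is the form in which convexity excludes that the slopes needed
  on the left and on the right of a supporting line are incompatible.
\<close>

lemma cost_class_convex_bound:
  assumes \<alpha>: "\<alpha> \<in> cost_class" and "0 \<le> v" "v < t" "t < u"
    and v: "\<alpha> v \<le> ereal (r + s * (v - t))" and u: "\<alpha> u \<le> ereal (r + s * (u - t))"
  shows "\<alpha> t \<le> ereal r"
proof -
  define l where "l = (t - v) / (u - v)"
  have l: "0 \<le> l" "l \<le> 1"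
    using assms by (auto simp: l_def field_simps)
  have lt: "l * (u - v) = t - v"
    using assms by (simp add: l_def)
  have t: "t = (1 - l) * v + l * u"
    using lt by (simp add: algebra_simps)
  have "\<alpha> ((1 - l) * v + l * u) \<le> ereal (1 - l) * \<alpha> v + ereal l * \<alpha> u"
    using \<alpha> l assms(2-4) unfolding cost_class_def by auto
  also have "\<dots> \<le> ereal (1 - l) * ereal (r + s * (v - t)) + ereal l * ereal (r + s * (u - t))"
    using l by (intro add_mono ereal_mult_left_mono v u) auto
  also have "\<dots> = ereal (r + s * ((1 - l) * v + l * u - t))"
    by (simp add: algebra_simps)
  finally show ?thesis
    by (simp flip: t)
qed

text \<open>
  Every point strictly below the graph lies on a line of nonnegative slope that stays below the
  whole graph. The slope is the least one that works on the left of \<open>t\<close>, the supremum of the slopes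
  of the chords from the point \<open>(t, r)\<close> to the graph on \<open>[0, t)\<close>. It is finite because left
  continuity keeps the graph above \<open>r\<close> on some interval before \<open>t\<close>, and nonnegative because the
  graph starts at the origin. It also works on the right of \<open>t\<close>, by convexity. Allowing a strict
  gap between \<open>r\<close> and \<open>\<alpha> t\<close> is necessary: at an end of the domain of \<open>\<alpha>\<close> the graph itself may
  have a vertical tangent.
\<close>

lemma cost_class_supporting_line:
  assumes \<alpha>: "\<alpha> \<in> cost_class" and "0 < t" "0 \<le> r" and r: "ereal r < \<alpha> t"
  obtains s where "0 \<le> s" "\<And>u. 0 \<le> u \<Longrightarrow> ereal (r + s * (u - t)) \<le> \<alpha> u"
proof -
  have "eventually (\<lambda>x. ereal r < \<alpha> x) (at_left t)"
    using order_tendstoD(1)[OF cost_class_left_continuous[OF \<alpha> \<open>0 < t\<close>] r] .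
  then obtain b where b: "b < t" "\<And>y. b < y \<Longrightarrow> y < t \<Longrightarrow> ereal r < \<alpha> y"
    by (metis eventually_at_left_field)
  obtain t' where t': "max b 0 < t'" "t' < t"
    using dense[of "max b 0" t] b(1) \<open>0 < t\<close> by auto
  have rt': "ereal r < \<alpha> t'"
    using b(2) t' by auto
  \<comment> \<open>The slopes \<open>s\<close> for which the line through \<open>(t, r)\<close> is already above the graph somewhere on
    \<open>[0, t)\<close>; the points where \<open>\<alpha>\<close> is infinite drop out by themselves.\<close>
  define S where "S = {s. \<exists>v. 0 \<le> v \<and> v < t \<and> \<alpha> v \<le> ereal (r - s * (t - v))}"
  have 0: "0 \<in> S"
    using \<open>0 < t\<close> \<open>0 \<le> r\<close> cost_class_zero[OF \<alpha>] by (auto simp: S_def intro!: exI[of _ 0])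
  have bound: "s \<le> r / (t - t')" if "s \<in> S" for s
  proof (cases "s \<le> 0")
    case True
    then show ?thesis
      using t' \<open>0 \<le> r\<close> by (smt (verit) divide_nonneg_pos)
  next
    case False
    obtain v where v: "0 \<le> v" "v < t" "\<alpha> v \<le> ereal (r - s * (t - v))"
      using \<open>s \<in> S\<close> by (auto simp: S_def)
    have "0 \<le> s * (t - v)"
      using False v by simp
    then have "\<alpha> v \<le> ereal r"
      using v(3) by (meson diff_left_mono ereal_less_eq(3) order_trans diff_le_eq le_add_same_cancel1)
    have "v < t'"
    proof (rule ccontr)
      assume "\<not> v < t'"
      then have "\<alpha> t' \<le> \<alpha> v"
        using t' by (intro cost_class_mono[OF \<alpha>]) auto
      with \<open>\<alpha> v \<le> ereal r\<close> rt' show False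
        by (meson leD order_trans)
    qed
    have "0 \<le> ereal (r - s * (t - v))"
      using v(3) cost_class_nonneg[OF \<alpha> v(1)] by (rule order_trans[rotated])
    then have "s * (t - v) \<le> r"
      by simp
    moreover have "s * (t - t') \<le> s * (t - v)"
      using False \<open>v < t'\<close> by (intro mult_left_mono) auto
    ultimately show ?thesis
      using t' by (simp add: field_simps)
  qed
  have bdd: "bdd_above S"
    using bound by (auto simp: bdd_above_def)
  define s where "s = Sup S"
  have "0 \<le> s"
    unfolding s_def using 0 bdd by (rule cSup_upper)
  moreover have "ereal (r + s * (u - t)) \<le> \<alpha> u" if "0 \<le> u" for u
  proof (rule ccontr)
    assume *: "\<not> ereal (r + s * (u - t)) \<le> \<alpha> u"
    then obtain x where x: "\<alpha> u \<le> ereal x" "x < r + s * (u - t)"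
      by (metis ereal_dense2 less_ereal.simps(1) less_imp_le not_le)
    consider "u < t" | "u = t" | "t < u"
      by linarith
    then show False
    proof cases
      case 1
      define s' where "s' = (r - x) / (t - u)"
      have "s' * (t - u) = r - x"
        using 1 by (simp add: s'_def)
      then have "s' \<in> S"
        using 1 x(1) that by (auto simp: S_def intro!: exI[of _ u])
      then have "s' \<le> s"
        unfolding s_def using bdd by (rule cSup_upper)
      then have "s' * (t - u) \<le> s * (t - u)"
        using 1 by (intro mult_right_mono) auto
      then show False
        using \<open>s' * (t - u) = r - x\<close> x(2) by (simp add: algebra_simps)
    next
      case 2
      then show False
        using * r by simp
    next
      case 3
      have "(x - r) / (u - t) < s"
        using 3 x(2) by (simp add: field_simps)
      then obtain s' where s': "s' \<in> S" "(x - r) / (u - t) < s'"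
        unfolding s_def using less_cSup_iff[OF _ bdd] 0 by blast
      then obtain v where v: "0 \<le> v" "v < t" "\<alpha> v \<le> ereal (r - s' * (t - v))"
        by (auto simp: S_def)
      have "x \<le> r + s' * (u - t)"
        using s'(2) 3 by (simp add: field_simps)
      then have "\<alpha> u \<le> ereal (r + s' * (u - t))"
        using x(1) by (meson ereal_less_eq(3) order_trans)
      moreover have "\<alpha> v \<le> ereal (r + s' * (v - t))"
        using v(3) by (simp add: algebra_simps)
      ultimately have "\<alpha> t \<le> ereal r"
        using cost_class_convex_bound[OF \<alpha> v(1,2) 3] by blast
      with r show False
        by simp
    qed
  qed
  ultimately show thesis
    by (rule that)
qed

lemma monotone_conjugate_upper:
  "0 \<le> t \<Longrightarrow> ereal (s * t) - \<alpha> t \<le> monotone_conjugate \<alpha> s"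
  unfolding monotone_conjugate_def by (rule SUP_upper) simp

lemma monotone_conjugate_nonneg:
  "\<alpha> \<in> cost_class \<Longrightarrow> 0 \<le> monotone_conjugate \<alpha> s"
  using monotone_conjugate_upper[of 0 s \<alpha>] by (simp add: cost_class_zero zero_ereal_def)

text \<open>
  The nontrivial half of \<open>\<alpha>\<^sup>\<circledast>\<^sup>\<circledast> = \<alpha>\<close>, phrased as a rule for bounding \<open>\<alpha> t\<close>: a line
  \<open>u \<mapsto> r + s * (u - t)\<close> below the graph means \<open>\<alpha>\<^sup>\<circledast> s \<le> s * t - r\<close>, so an \<open>r\<close> strictly between \<open>C\<close> and
  \<open>\<alpha> t\<close> would contradict the assumption.
\<close>

lemma monotone_biconjugate:
  assumes \<alpha>: "\<alpha> \<in> cost_class" and "0 \<le> t"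
    and le: "\<And>s. 0 \<le> s \<Longrightarrow> ereal (s * t) - monotone_conjugate \<alpha> s \<le> C"
  shows "\<alpha> t \<le> C"
proof -
  have "monotone_conjugate \<alpha> 0 \<le> 0"
    unfolding monotone_conjugate_def
    using cost_class_nonneg[OF \<alpha>] by (intro SUP_least) (auto simp flip: zero_ereal_def simp: ereal_uminus_le_0_iff)
  \<comment> \<open>The slope \<open>0\<close> shows that \<open>C\<close> is nonnegative, so that supporting lines exist at heights above \<open>C\<close>.\<close>
  then have "0 \<le> C"
    using le[of 0] monotone_conjugate_nonneg[OF \<alpha>, of 0] by (simp flip: zero_ereal_def)
  show ?thesis
  proof (rule ccontr)
    assume "\<not> \<alpha> t \<le> C"
    then have "C < \<alpha> t"
      by simp
    then obtain r where r: "C < ereal r" "ereal r < \<alpha> t"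
      using ereal_dense2 by blast
    have "0 \<le> r"
      using \<open>0 \<le> C\<close> r(1) by (metis ereal_less_eq(5) less_imp_le order_trans)
    have "t \<noteq> 0"
      using cost_class_zero[OF \<alpha>] \<open>0 \<le> C\<close> \<open>C < \<alpha> t\<close> by auto
    then obtain s where s: "0 \<le> s" "\<And>u. 0 \<le> u \<Longrightarrow> ereal (r + s * (u - t)) \<le> \<alpha> u"
      using cost_class_supporting_line[OF \<alpha> _ \<open>0 \<le> r\<close> r(2)] \<open>0 \<le> t\<close> by (metis less_eq_real_def)
    have "monotone_conjugate \<alpha> s \<le> ereal (s * t - r)"
      unfolding monotone_conjugate_def
    proof (rule SUP_least)
      fix u :: real assume "u \<in> {0..}"
      then show "ereal (s * u) - \<alpha> u \<le> ereal (s * t - r)"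
        using s(2)[of u] by (cases "\<alpha> u") (auto simp: algebra_simps)
    qed
    then have "ereal r \<le> ereal (s * t) - monotone_conjugate \<alpha> s"
      by (cases "monotone_conjugate \<alpha> s") (auto simp: algebra_simps)
    with le[OF s(1)] r(1) show False
      by (meson leD order_trans)
  qed
qed

lemma Lim_at_top_mono_on:
  fixes \<alpha> :: "real \<Rightarrow> ereal"
  assumes "mono_on {0..} \<alpha>"
  shows "Lim at_top \<alpha> = (SUP u\<in>{0..}. \<alpha> u)"
proof (rule tendsto_Lim)
  show "(\<alpha> \<longlongrightarrow> (SUP u\<in>{0..}. \<alpha> u)) at_top"
  proof (rule order_tendstoI)
    fix y assume "y < (SUP u\<in>{0..}. \<alpha> u)"
    then obtain u where u: "0 \<le> u" "y < \<alpha> u"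
      by (auto simp: less_SUP_iff)
    show "eventually (\<lambda>x. y < \<alpha> x) at_top"
      using eventually_ge_at_top[of u]
    proof eventually_elim
      case (elim x)
      then have "\<alpha> u \<le> \<alpha> x"
        using u by (intro mono_onD[OF assms]) auto
      with u show ?case by order
    qed
  next
    fix y assume y: "(SUP u\<in>{0..}. \<alpha> u) < y"
    show "eventually (\<lambda>x. \<alpha> x < y) at_top"
      using eventually_ge_at_top[of 0]
    proof eventually_elim
      case (elim x)
      then have "\<alpha> x \<le> (SUP u\<in>{0..}. \<alpha> u)"
        by (intro SUP_upper) auto
      with y show ?case by order
    qed
  qed
qed simp

lemma extend_at_infinity_ge:
  assumes \<alpha>: "\<alpha> \<in> cost_class" and "0 \<le> u" and T: "ereal u \<le> T"
  shows "\<alpha> u \<le> extend_at_infinity \<alpha> T"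
proof (cases T)
  case (real \<tau>)
  then show ?thesis
    using T cost_class_mono[OF \<alpha> \<open>0 \<le> u\<close>] by (simp add: extend_at_infinity_def)
next
  case PInf
  have "\<alpha> u \<le> (SUP u\<in>{0..}. \<alpha> u)"
    using \<open>0 \<le> u\<close> by (intro SUP_upper) auto
  then show ?thesis
    using PInf \<alpha> by (simp add: extend_at_infinity_def Lim_at_top_mono_on cost_class_def)
next
  case MInf
  then show ?thesis using T by simp
qed

text \<open>
  At a finite \<open>T > 0\<close> this is left continuity, and at \<open>T = \<infinity>\<close> it is the definition of the extension as
  a limit. The bound is only asked for below \<open>T\<close> since the supremum in the transport cost need not
  be attained.
\<close>

lemma extend_at_infinity_le:
  assumes \<alpha>: "\<alpha> \<in> cost_class" and T: "0 \<le> T" and C: "0 \<le> C"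
    and le: "\<And>u. 0 \<le> u \<Longrightarrow> ereal u < T \<Longrightarrow> \<alpha> u \<le> C"
  shows "extend_at_infinity \<alpha> T \<le> C"
proof (cases T)
  case (real \<tau>)
  show ?thesis
  proof (cases "\<tau> = 0")
    case True
    then show ?thesis
      using real C cost_class_zero[OF \<alpha>] by (simp add: extend_at_infinity_def)
  next
    case False
    then have "0 < \<tau>"
      using T real by simp
    have "eventually (\<lambda>u. \<alpha> u \<le> C) (at_left \<tau>)"
      using eventually_at_left_real[OF \<open>0 < \<tau>\<close>] by eventually_elim (auto intro!: le simp: real)
    then have "\<alpha> \<tau> \<le> C"
      by (rule tendsto_upperbound[OF cost_class_left_continuous[OF \<alpha> \<open>0 < \<tau>\<close>]]) simp
    then show ?thesis
      by (simp add: real extend_at_infinity_def)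
  qed
next
  case PInf
  then show ?thesis
    using \<alpha> le by (auto simp: extend_at_infinity_def Lim_at_top_mono_on cost_class_def intro!: SUP_least)
next
  case MInf
  then show ?thesis using T by simp
qed

section \<open>Relative entropy and the Donsker--Varadhan formula\<close>

text \<open>
  Exponential moments of both signs give first moments, since \<open>\<bar>y\<bar> \<le> exp y + exp (- y)\<close>. The weight
  \<open>w\<close> will be a density with respect to \<open>M\<close>.
\<close>

lemma integrable_of_integrable_exp:
  fixes f :: "'a \<Rightarrow> real"
  assumes [measurable]: "f \<in> borel_measurable M" "w \<in> borel_measurable M"
    and w: "\<And>x. 0 \<le> w x"
    and "integrable M (\<lambda>x. w x * exp (f x))" "integrable M (\<lambda>x. w x * exp (- f x))"
  shows "integrable M (\<lambda>x. w x * f x)"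
proof (rule Bochner_Integration.integrable_bound[OF Bochner_Integration.integrable_add[OF assms(4,5)]])
  show "AE x in M. norm (w x * f x) \<le> norm (w x * exp (f x) + w x * exp (- f x))"
  proof (rule AE_I2)
    fix x
    have "\<bar>f x\<bar> \<le> exp (f x) + exp (- f x)"
      using exp_ge_add_one_self[of "f x"] exp_ge_add_one_self[of "- f x"]
        exp_gt_zero[of "f x"] exp_gt_zero[of "- f x"] by linarith
    then have "w x * \<bar>f x\<bar> \<le> w x * (exp (f x) + exp (- f x))"
      by (intro mult_left_mono w)
    then show "norm (w x * f x) \<le> norm (w x * exp (f x) + w x * exp (- f x))"
      using w[of x] by (simp add: abs_mult algebra_simps)
  qed
qed simp

lemma (in prob_space) integral_exp_pos:
  fixes q :: "'a \<Rightarrow> real"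
  assumes "integrable M (\<lambda>x. exp (q x))"
  shows "0 < (\<integral>x. exp (q x) \<partial>M)"
proof -
  have "0 \<le> (\<integral>x. exp (q x) \<partial>M)"
    by simp
  moreover have "(\<integral>x. exp (q x) \<partial>M) \<noteq> 0"
    using integral_nonneg_eq_0_iff_AE[OF assms] by (simp add: AE_False)
  ultimately show ?thesis
    by linarith
qed

text \<open>
  Young's inequality for the conjugate pair \<open>g * ln g - g\<close> and \<open>exp q\<close>. At \<open>g = 0\<close> it holds because of
  the convention \<open>0 * ln 0 = 0\<close>.
\<close>

lemma mult_le_ln_exp:
  fixes g q :: real
  assumes "0 \<le> g"
  shows "g * q \<le> g * ln g - g + exp q"
proof (cases "g = 0")
  case False
  then have "g * (1 + (q - ln g)) \<le> g * exp (q - ln g)"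
    using assms by (intro mult_left_mono exp_ge_add_one_self) auto
  also have "\<dots> = exp q"
    using False assms by (simp add: exp_diff)
  finally show ?thesis
    by (simp add: algebra_simps)
qed simp

lemma ext_integral_eq_integral:
  assumes "integrable M f"
  shows "ext_integral M f = ereal (\<integral>x. f x \<partial>M)"
proof -
  have pm: "integrable M (\<lambda>x. max 0 (f x))" "integrable M (\<lambda>x. max 0 (- f x))"
    using assms by auto
  have *: "enn2ereal (\<integral>\<^sup>+x. ennreal (h x) \<partial>M) = ereal (\<integral>x. max 0 (h x) \<partial>M)"
    if "integrable M (\<lambda>x. max 0 (h x))" for h
  proof -
    have "(\<integral>\<^sup>+x. ennreal (h x) \<partial>M) = (\<integral>\<^sup>+x. ennreal (max 0 (h x)) \<partial>M)"
      by (intro nn_integral_cong) (simp add: max_def ennreal_neg)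
    also have "\<dots> = ennreal (\<integral>x. max 0 (h x) \<partial>M)"
      using that by (intro nn_integral_eq_integral) auto
    finally show ?thesis
      by (simp add: enn2ereal_ennreal)
  qed
  have "ext_integral M f = ereal ((\<integral>x. max 0 (f x) \<partial>M) - (\<integral>x. max 0 (- f x) \<partial>M))"
    by (simp add: ext_integral_def * pm)
  also have "(\<integral>x. max 0 (f x) \<partial>M) - (\<integral>x. max 0 (- f x) \<partial>M) = (\<integral>x. f x \<partial>M)"
    unfolding Bochner_Integration.integral_diff[OF pm, symmetric]
    by (intro Bochner_Integration.integral_cong) (auto simp: max_def)
  finally show ?thesis .
qed

text \<open>
  Write \<open>\<nu> = g \<mu>\<close> and normalise \<open>q\<close> so that \<open>exp q\<close> has integral \<open>1\<close>. Integrating Young's inequality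
  \<open>g * q \<le> g * ln g - g + exp q\<close> with respect to \<open>\<mu>\<close> gives \<open>\<integral>q d\<nu> \<le> H(\<nu>|\<mu>) - 1 + 1\<close>. This presupposes
  that \<open>ln g\<close> is integrable with respect to \<open>\<nu>\<close>; otherwise the entropy is infinite, because the
  negative part of \<open>ln g\<close> always has a finite integral.
\<close>

lemma Donsker_Varadhan_inequality:
  fixes q :: "'a \<Rightarrow> real"
  assumes "prob_space \<mu>" "prob_space \<nu>" and sets[measurable_cong]: "sets \<nu> = sets \<mu>"
    and q: "integrable \<nu> q" and e: "integrable \<mu> (\<lambda>x. exp (q x))"
  shows "ereal ((\<integral>x. q x \<partial>\<nu>) - ln (\<integral>x. exp (q x) \<partial>\<mu>)) \<le> relative_entropy \<nu> \<mu>"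
proof (cases "absolutely_continuous \<mu> \<nu>")
  case False
  then show ?thesis by (simp add: relative_entropy_def)
next
  case ac: True
  interpret \<mu>: prob_space \<mu> by fact
  interpret \<nu>: prob_space \<nu> by fact
  define g where "g x = enn2real (RN_deriv \<mu> \<nu> x)" for x
  define h where "h x = ln (g x)" for x
  have g0: "0 \<le> g x" for x
    by (simp add: g_def)
  have [measurable]: "g \<in> borel_measurable \<mu>" "h \<in> borel_measurable \<mu>"
    unfolding g_def h_def by measurable
  have int_iff: "integrable \<nu> f \<longleftrightarrow> integrable \<mu> (\<lambda>x. g x * f x)"
    and int_eq: "(\<integral>x. f x \<partial>\<nu>) = (\<integral>x. g x * f x \<partial>\<mu>)"
    if "f \<in> borel_measurable \<mu>" for f :: "'a \<Rightarrow> real"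
    unfolding g_def
    using \<mu>.RN_deriv_integrable[OF \<nu>.sigma_finite_measure_axioms ac sets that]
      \<mu>.RN_deriv_integral[OF \<nu>.sigma_finite_measure_axioms ac sets that] by auto
  have [measurable]: "q \<in> borel_measurable \<mu>"
    using borel_measurable_integrable[OF q] by simp
  have g: "integrable \<mu> g" "(\<integral>x. g x \<partial>\<mu>) = 1"
    using int_iff[of "\<lambda>_. 1"] int_eq[of "\<lambda>_. 1"] by (auto simp: \<nu>.prob_space)
  have H: "relative_entropy \<nu> \<mu> = ext_integral \<nu> h"
    using ac by (simp add: relative_entropy_def h_def[abs_def] g_def)
  have neg: "(\<integral>\<^sup>+x. ennreal (- h x) \<partial>\<nu>) \<noteq> \<infinity>"
  proof -
    have "integrable \<mu> (\<lambda>x. g x * max 0 (- h x))"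
    proof (rule \<mu>.integrable_const_bound[where B = 1])
      \<comment> \<open>Young's inequality at \<open>q = 0\<close> bounds \<open>- g * ln g\<close> by \<open>1 - g\<close>.\<close>
      have "g x * max 0 (- h x) \<le> 1" for x
        using mult_le_ln_exp[OF g0[of x], of 0] g0[of x]
        by (auto simp: h_def max_def algebra_simps)
      then show "AE x in \<mu>. norm (g x * max 0 (- h x)) \<le> 1"
        using g0 by (simp add: abs_mult)
    qed simp
    then have "integrable \<nu> (\<lambda>x. max 0 (- h x))"
      by (subst int_iff) auto
    then have "(\<integral>\<^sup>+x. ennreal (max 0 (- h x)) \<partial>\<nu>) < \<infinity>"
      by (simp add: integrable_iff_bounded)
    moreover have "(\<integral>\<^sup>+x. ennreal (max 0 (- h x)) \<partial>\<nu>) = (\<integral>\<^sup>+x. ennreal (- h x) \<partial>\<nu>)"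
      by (intro nn_integral_cong) (simp add: max_def ennreal_neg)
    ultimately show ?thesis by simp
  qed
  show ?thesis
  proof (cases "integrable \<nu> h")
    case False
    have "(\<integral>\<^sup>+x. ennreal (h x) \<partial>\<nu>) = \<infinity>"
    proof (rule ccontr)
      assume "\<not> ?thesis"
      then have "integrable \<nu> h"
        using neg by (intro real_integrable_def[THEN iffD2]) auto
      with False show False ..
    qed
    then show ?thesis
      using neg unfolding H ext_integral_def
      by (cases "\<integral>\<^sup>+x. ennreal (- h x) \<partial>\<nu>") (auto simp: enn2ereal_ennreal)
  next
    case True
    define Z where "Z = (\<integral>x. exp (q x) \<partial>\<mu>)"
    have "0 < Z"
      unfolding Z_def by (rule \<mu>.integral_exp_pos[OF e])
    have i1: "integrable \<mu> (\<lambda>x. g x * (q x - ln Z))"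
      using q by (subst int_iff[symmetric]) auto
    have i2: "integrable \<mu> (\<lambda>x. g x * h x)"
      using True by (subst int_iff[symmetric]) auto
    have i3: "integrable \<mu> (\<lambda>x. exp (q x - ln Z))"
      using e \<open>0 < Z\<close> by (simp add: exp_diff)
    have "(\<integral>x. q x \<partial>\<nu>) - ln Z = (\<integral>x. q x - ln Z \<partial>\<nu>)"
      using q by (simp add: \<nu>.prob_space)
    also have "\<dots> = (\<integral>x. g x * (q x - ln Z) \<partial>\<mu>)"
      by (rule int_eq) simp
    also have "\<dots> \<le> (\<integral>x. g x * h x - g x + exp (q x - ln Z) \<partial>\<mu>)"
      using i1 i2 i3 g(1) mult_le_ln_exp[OF g0]
      by (intro integral_mono) (auto simp: h_def)
    also have "\<dots> = (\<integral>x. g x * h x \<partial>\<mu>) - 1 + (\<integral>x. exp (q x - ln Z) \<partial>\<mu>)"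
      using i1 i2 i3 g by simp
    also have "(\<integral>x. exp (q x - ln Z) \<partial>\<mu>) = 1"
      using \<open>0 < Z\<close> by (simp add: exp_diff flip: Z_def)
    also have "(\<integral>x. g x * h x \<partial>\<mu>) = (\<integral>x. h x \<partial>\<nu>)"
      by (rule int_eq[symmetric]) simp
    finally show ?thesis
      using ext_integral_eq_integral[OF True] by (simp add: H Z_def)
  qed
qed

text \<open>
  The normalising constant is kept inside the exponential, so that the logarithm of the density is
  visibly \<open>q\<close> minus a constant.
\<close>

definition gibbs_measure :: "'a measure \<Rightarrow> ('a \<Rightarrow> real) \<Rightarrow> 'a measure" where
  "gibbs_measure \<mu> q = density \<mu> (\<lambda>x. ennreal (exp (q x - ln (\<integral>y. exp (q y) \<partial>\<mu>))))"

lemma sets_gibbs_measure [simp]: "sets (gibbs_measure \<mu> q) = sets \<mu>"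
  by (simp add: gibbs_measure_def)

lemma prob_space_gibbs_measure:
  assumes "prob_space \<mu>" and e: "integrable \<mu> (\<lambda>x. exp (q x))"
    and [measurable]: "q \<in> borel_measurable \<mu>"
  shows "prob_space (gibbs_measure \<mu> q)"
proof
  interpret \<mu>: prob_space \<mu> by fact
  define Z where "Z = (\<integral>x. exp (q x) \<partial>\<mu>)"
  have "0 < Z"
    unfolding Z_def by (rule \<mu>.integral_exp_pos[OF e])
  have "integrable \<mu> (\<lambda>x. exp (q x - ln Z))"
    using e \<open>0 < Z\<close> by (simp add: exp_diff)
  then have "(\<integral>\<^sup>+x. ennreal (exp (q x - ln Z)) \<partial>\<mu>) = ennreal (\<integral>x. exp (q x - ln Z) \<partial>\<mu>)"
    by (intro nn_integral_eq_integral) auto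
  also have "\<dots> = 1"
    using \<open>0 < Z\<close> by (simp add: exp_diff flip: Z_def)
  finally have "(\<integral>\<^sup>+x. ennreal (exp (q x - ln Z)) \<partial>\<mu>) = 1" .
  moreover have "emeasure (gibbs_measure \<mu> q) (space \<mu>) = (\<integral>\<^sup>+x. ennreal (exp (q x - ln Z)) \<partial>\<mu>)"
    by (simp add: gibbs_measure_def Z_def emeasure_density)
  ultimately show "emeasure (gibbs_measure \<mu> q) (space (gibbs_measure \<mu> q)) = 1"
    by (simp add: gibbs_measure_def)
qed

lemma integrable_gibbs_measure:
  assumes "prob_space \<mu>" and e: "integrable \<mu> (\<lambda>x. exp (q x))"
    and [measurable]: "q \<in> borel_measurable \<mu>" "g \<in> borel_measurable \<mu>"
    and p: "integrable \<mu> (\<lambda>x. exp (q x + g x))" and m: "integrable \<mu> (\<lambda>x. exp (q x - g x))"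
  shows "integrable (gibbs_measure \<mu> q) g"
proof -
  define L where "L = ln (\<integral>x. exp (q x) \<partial>\<mu>)"
  have "integrable \<mu> (\<lambda>x. exp (q x - L) * g x)"
  proof (rule integrable_of_integrable_exp)
    have "(\<lambda>x. exp (q x - L) * exp (g x)) = (\<lambda>x. exp (q x + g x) / exp L)"
      "(\<lambda>x. exp (q x - L) * exp (- g x)) = (\<lambda>x. exp (q x - g x) / exp L)"
      by (auto simp: exp_diff exp_add exp_minus field_simps)
    then show "integrable \<mu> (\<lambda>x. exp (q x - L) * exp (g x))"
      "integrable \<mu> (\<lambda>x. exp (q x - L) * exp (- g x))"
      using p m by auto
  qed auto
  then show ?thesis
    by (simp add: gibbs_measure_def integrable_real_density flip: L_def)
qed

text \<open>
  Gibbs measures are the case of equality in the Donsker--Varadhan inequality: the logarithm of the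
  density of \<open>gibbs_measure \<mu> q\<close> is \<open>q\<close> minus the logarithm of the normalising constant.
\<close>

lemma relative_entropy_gibbs_measure:
  assumes "prob_space \<mu>" and e: "integrable \<mu> (\<lambda>x. exp (q x))"
    and [measurable]: "q \<in> borel_measurable \<mu>" and q: "integrable (gibbs_measure \<mu> q) q"
  shows "relative_entropy (gibbs_measure \<mu> q) \<mu> =
    ereal ((\<integral>x. q x \<partial>gibbs_measure \<mu> q) - ln (\<integral>x. exp (q x) \<partial>\<mu>))"
proof -
  interpret \<mu>: prob_space \<mu> by fact
  define \<nu> where "\<nu> = gibbs_measure \<mu> q"
  interpret \<nu>: prob_space \<nu>
    unfolding \<nu>_def using assms(1-3) by (rule prob_space_gibbs_measure)
  define L where "L = ln (\<integral>x. exp (q x) \<partial>\<mu>)"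
  have dens: "\<nu> = density \<mu> (\<lambda>x. ennreal (exp (q x - L)))"
    by (simp add: \<nu>_def gibbs_measure_def L_def)
  have sets[measurable_cong]: "sets \<nu> = sets \<mu>"
    by (simp add: dens)
  have ac: "absolutely_continuous \<mu> \<nu>"
    unfolding dens by (rule absolutely_continuousI_density) simp
  have "AE x in \<mu>. ennreal (exp (q x - L)) = RN_deriv \<mu> \<nu> x"
    by (rule \<mu>.RN_deriv_unique) (auto simp: dens)
  then have "AE x in \<nu>. ennreal (exp (q x - L)) = RN_deriv \<mu> \<nu> x"
    by (rule absolutely_continuous_AE[OF sets ac])
  then have ae: "AE x in \<nu>. ln (enn2real (RN_deriv \<mu> \<nu> x)) = q x - L"
    by eventually_elim (metis enn2real_ennreal exp_ge_zero ln_exp)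
  have "relative_entropy \<nu> \<mu> = ext_integral \<nu> (\<lambda>x. q x - L)"
    using ae ac unfolding relative_entropy_def ext_integral_def
    by (auto intro!: arg_cong2[where f = "(-)"] arg_cong[where f = enn2ereal] nn_integral_cong_AE)
  also have "\<dots> = ereal (\<integral>x. q x - L \<partial>\<nu>)"
    using q by (intro ext_integral_eq_integral) (auto simp: \<nu>_def[symmetric])
  also have "(\<integral>x. q x - L \<partial>\<nu>) = (\<integral>x. q x \<partial>\<nu>) - L"
    using q by (simp add: \<nu>.prob_space flip: \<nu>_def)
  finally show ?thesis
    by (simp add: \<nu>_def L_def)
qed

section \<open>Transport-entropy inequality, log-Laplace transform and its conjugate\<close>

locale exp_integrable_functions =
  fixes \<mu> :: "'a::topological_space measure" and F :: "('a \<Rightarrow> real) set"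
  assumes mu: "\<mu> \<in> borel_prob_measures"
    and F: "function_space F"
    and F_measurable: "F \<subseteq> borel_measurable borel"
    and integrable_exp: "\<phi> \<in> F \<Longrightarrow> integrable \<mu> (\<lambda>x. exp (\<phi> x))"
begin

sublocale \<mu>: prob_space \<mu>
  using mu by (simp add: borel_prob_measures_def)

lemma sets_mu [measurable_cong]: "sets \<mu> = sets borel"
  using mu by (simp add: borel_prob_measures_def)

lemma measurable_F [measurable (raw)]: "\<phi> \<in> F \<Longrightarrow> \<phi> \<in> borel_measurable borel"
  using F_measurable by blast

lemma add_F: "f \<in> F \<Longrightarrow> g \<in> F \<Longrightarrow> (\<lambda>x. f x + g x) \<in> F"
  and scale_F: "f \<in> F \<Longrightarrow> (\<lambda>x. s * f x) \<in> F"
  using F by (auto simp: function_space_def)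

text \<open>
  Since the functions form a vector space, integrability of \<open>exp \<circ> f\<close> for each of them means
  exponential moments of every order, also under the Gibbs measures of \<open>s * (f + c)\<close>; the summand
  \<open>r * g\<close> is there for the latter.
\<close>

lemma integrable_exp_affine:
  assumes "f \<in> F" "g \<in> F"
  shows "integrable \<mu> (\<lambda>x. exp (s * (f x + c) + r * g x))"
proof -
  have "integrable \<mu> (\<lambda>x. exp (s * f x + r * g x) * exp (s * c))"
    by (intro integrable_mult_left integrable_exp add_F scale_F assms)
  then show ?thesis
    by (simp add: algebra_simps flip: exp_add)
qed

lemma integrable_exp_scale: "f \<in> F \<Longrightarrow> integrable \<mu> (\<lambda>x. exp (s * (f x + c)))"
  using integrable_exp_affine[of f f s c 0] by simp

lemma exp_log_laplace:
  assumes "\<phi> \<in> F"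
  shows "exp (log_laplace \<mu> \<psi> \<phi> s) = (\<integral>x. exp (s * (\<phi> x + (\<integral>y. \<psi> y \<partial>\<mu>))) \<partial>\<mu>)"
  unfolding log_laplace_def
  by (rule exp_ln[OF \<mu>.integral_exp_pos[OF integrable_exp_scale[OF assms]]])

lemma entropy_duality_le:
  assumes \<nu>: "\<nu> \<in> prob_measures_integrating F" and "\<phi> \<in> F"
  shows "ereal (s * ((\<integral>x. \<psi> x \<partial>\<mu>) + (\<integral>x. \<phi> x \<partial>\<nu>)) - log_laplace \<mu> \<psi> \<phi> s)
    \<le> relative_entropy \<nu> \<mu>"
proof -
  define c where "c = (\<integral>x. \<psi> x \<partial>\<mu>)"
  interpret \<nu>: prob_space \<nu>
    using \<nu> by (simp add: prob_measures_integrating_def borel_prob_measures_def)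
  have "sets \<nu> = sets \<mu>" and int: "integrable \<nu> \<phi>"
    using assms sets_mu by (auto simp: prob_measures_integrating_def borel_prob_measures_def)
  then have "ereal ((\<integral>x. s * (\<phi> x + c) \<partial>\<nu>) - ln (\<integral>x. exp (s * (\<phi> x + c)) \<partial>\<mu>))
    \<le> relative_entropy \<nu> \<mu>"
    by (intro Donsker_Varadhan_inequality integrable_exp_scale[OF \<open>\<phi> \<in> F\<close>]
        \<mu>.prob_space_axioms \<nu>.prob_space_axioms) auto
  also have "(\<integral>x. s * (\<phi> x + c) \<partial>\<nu>) = s * (c + (\<integral>x. \<phi> x \<partial>\<nu>))"
    using int by (simp add: \<nu>.prob_space)
  finally show ?thesis
    by (simp add: log_laplace_def c_def)
qed

text \<open>
  The optimal \<open>\<nu>\<close> is the Gibbs measure of \<open>s * (\<phi> + c)\<close>. It integrates all of \<open>F\<close>, so it may be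
  inserted into a transport-entropy inequality on \<open>prob_measures_integrating F\<close>.
\<close>

lemma entropy_duality_attained:
  assumes "\<phi> \<in> F"
  obtains \<nu> where "\<nu> \<in> prob_measures_integrating F"
    "relative_entropy \<nu> \<mu> =
      ereal (s * ((\<integral>x. \<psi> x \<partial>\<mu>) + (\<integral>x. \<phi> x \<partial>\<nu>)) - log_laplace \<mu> \<psi> \<phi> s)"
proof -
  define c where "c = (\<integral>x. \<psi> x \<partial>\<mu>)"
  define q where "q x = s * (\<phi> x + c)" for x
  define \<nu> where "\<nu> = gibbs_measure \<mu> q"
  have exp_q: "integrable \<mu> (\<lambda>x. exp (q x))"
    unfolding q_def by (rule integrable_exp_scale[OF assms])
  have [measurable]: "q \<in> borel_measurable \<mu>"
    unfolding q_def using assms by measurable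
  interpret \<nu>: prob_space \<nu>
    unfolding \<nu>_def by (rule prob_space_gibbs_measure[OF \<mu>.prob_space_axioms exp_q]) simp
  have int: "integrable \<nu> g" if "g \<in> F" for g
    unfolding \<nu>_def
    using integrable_exp_affine[OF assms that, of s c 1] integrable_exp_affine[OF assms that, of s c "-1"] that
    by (intro integrable_gibbs_measure[OF \<mu>.prob_space_axioms exp_q])
      (auto simp: q_def[symmetric])
  have "\<nu> \<in> prob_measures_integrating F"
    using int \<nu>.prob_space_axioms sets_mu
    by (auto simp: prob_measures_integrating_def borel_prob_measures_def \<nu>_def)
  moreover have "integrable \<nu> q" "(\<integral>x. q x \<partial>\<nu>) = s * (c + (\<integral>x. \<phi> x \<partial>\<nu>))"
    using int[OF assms] by (auto simp: q_def[abs_def] \<nu>.prob_space)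
  moreover have "relative_entropy \<nu> \<mu> = ereal ((\<integral>x. q x \<partial>\<nu>) - ln (\<integral>x. exp (q x) \<partial>\<mu>))"
    using \<open>integrable \<nu> q\<close> unfolding \<nu>_def
    by (intro relative_entropy_gibbs_measure[OF \<mu>.prob_space_axioms exp_q]) auto
  ultimately show thesis
    by (intro that[of \<nu>]) (auto simp: c_def q_def log_laplace_def)
qed

lemma log_laplace_conjugate_le_entropy:
  assumes "\<nu> \<in> prob_measures_integrating F" "\<phi> \<in> F"
  shows "log_laplace_conjugate \<mu> \<psi> \<phi> ((\<integral>x. \<psi> x \<partial>\<mu>) + (\<integral>x. \<phi> x \<partial>\<nu>)) \<le> relative_entropy \<nu> \<mu>"
  unfolding log_laplace_conjugate_def by (intro SUP_least entropy_duality_le assms)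

text \<open>
  Insert the Gibbs measure at \<open>s\<close>, for which \<open>H(\<nu>|\<mu>) = s * t - \<Lambda> s\<close>. If \<open>t \<ge> 0\<close>, the bound gives
  \<open>\<Lambda> s \<le> s * t - \<alpha> t\<close>. If \<open>t < 0\<close>, where \<open>\<alpha>\<close> carries no information, nonnegativity of the entropy
  alone gives \<open>\<Lambda> s \<le> s * t \<le> 0\<close>. Both the transport-entropy inequality and the lower bound on
  \<open>\<Lambda>\<^sup>*\<close> enter through this lemma.
\<close>

lemma log_laplace_le_conjugate_if_entropy_bound:
  assumes \<alpha>: "\<alpha> \<in> cost_class" and \<phi>: "\<phi> \<in> F" and "0 \<le> s"
    and bound: "\<And>\<nu>. \<nu> \<in> prob_measures_integrating F \<Longrightarrow> 0 \<le> (\<integral>x. \<psi> x \<partial>\<mu>) + (\<integral>x. \<phi> x \<partial>\<nu>) \<Longrightarrow>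
      \<alpha> ((\<integral>x. \<psi> x \<partial>\<mu>) + (\<integral>x. \<phi> x \<partial>\<nu>)) \<le> relative_entropy \<nu> \<mu>"
  shows "ereal (log_laplace \<mu> \<psi> \<phi> s) \<le> monotone_conjugate \<alpha> s"
proof -
  obtain \<nu> where \<nu>: "\<nu> \<in> prob_measures_integrating F"
    "relative_entropy \<nu> \<mu> =
      ereal (s * ((\<integral>x. \<psi> x \<partial>\<mu>) + (\<integral>x. \<phi> x \<partial>\<nu>)) - log_laplace \<mu> \<psi> \<phi> s)"
    by (rule entropy_duality_attained[OF \<phi>])
  define t where "t = (\<integral>x. \<psi> x \<partial>\<mu>) + (\<integral>x. \<phi> x \<partial>\<nu>)"
  have H: "relative_entropy \<nu> \<mu> = ereal (s * t - log_laplace \<mu> \<psi> \<phi> s)"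
    using \<nu>(2) by (simp add: t_def)
  show ?thesis
  proof (cases "0 \<le> t")
    case True
    have "\<alpha> t \<le> ereal (s * t - log_laplace \<mu> \<psi> \<phi> s)"
      using bound[OF \<nu>(1)] True H by (simp add: t_def)
    then have "ereal (log_laplace \<mu> \<psi> \<phi> s) \<le> ereal (s * t) - \<alpha> t"
      using cost_class_nonneg[OF \<alpha> True] by (cases "\<alpha> t") auto
    also have "\<dots> \<le> monotone_conjugate \<alpha> s"
      by (rule monotone_conjugate_upper[OF True])
    finally show ?thesis .
  next
    case False
    have "ereal 0 \<le> relative_entropy \<nu> \<mu>"
      using entropy_duality_le[OF \<nu>(1) \<phi>, of 0 \<psi>] by (simp add: log_laplace_def \<mu>.prob_space)
    then have "log_laplace \<mu> \<psi> \<phi> s \<le> s * t"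
      by (simp add: H)
    also have "\<dots> \<le> 0"
      using False \<open>0 \<le> s\<close> by (simp add: mult_nonneg_nonpos)
    finally have "ereal (log_laplace \<mu> \<psi> \<phi> s) \<le> 0"
      by simp
    also have "\<dots> \<le> monotone_conjugate \<alpha> s"
      by (rule monotone_conjugate_nonneg[OF \<alpha>])
    finally show ?thesis .
  qed
qed

lemma log_laplace_le_conjugate_if_cost_bound:
  assumes \<alpha>: "\<alpha> \<in> cost_class" and "\<Phi> \<subseteq> F \<times> F" and "(\<psi>, \<phi>) \<in> \<Phi>" "0 \<le> s"
    and cost: "\<And>\<nu>. \<nu> \<in> prob_measures_integrating F \<Longrightarrow>
      extend_at_infinity \<alpha> (transport_cost \<mu> \<Phi> \<nu>) \<le> relative_entropy \<nu> \<mu>"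
  shows "ereal (log_laplace \<mu> \<psi> \<phi> s) \<le> monotone_conjugate \<alpha> s"
proof (rule log_laplace_le_conjugate_if_entropy_bound[OF \<alpha>])
  fix \<nu> assume \<nu>: "\<nu> \<in> prob_measures_integrating F" and 0: "0 \<le> (\<integral>x. \<psi> x \<partial>\<mu>) + (\<integral>x. \<phi> x \<partial>\<nu>)"
  have "ereal ((\<integral>x. \<psi> x \<partial>\<mu>) + (\<integral>x. \<phi> x \<partial>\<nu>)) \<le> transport_cost \<mu> \<Phi> \<nu>"
    unfolding transport_cost_def using \<open>(\<psi>, \<phi>) \<in> \<Phi>\<close> by (intro SUP_upper2) auto
  then have "\<alpha> ((\<integral>x. \<psi> x \<partial>\<mu>) + (\<integral>x. \<phi> x \<partial>\<nu>)) \<le> extend_at_infinity \<alpha> (transport_cost \<mu> \<Phi> \<nu>)"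
    by (rule extend_at_infinity_ge[OF \<alpha> 0])
  also have "\<dots> \<le> relative_entropy \<nu> \<mu>"
    by (rule cost[OF \<nu>])
  finally show "\<alpha> ((\<integral>x. \<psi> x \<partial>\<mu>) + (\<integral>x. \<phi> x \<partial>\<nu>)) \<le> relative_entropy \<nu> \<mu>" .
qed (use assms in auto)

text \<open>
  For a single pair the biconjugate reduces \<open>\<alpha> t \<le> H(\<nu>|\<mu>)\<close> to \<open>s * t - \<alpha>\<^sup>\<circledast> s \<le> H(\<nu>|\<mu>)\<close>, which follows
  from entropy duality and \<open>\<Lambda> s \<le> \<alpha>\<^sup>\<circledast> s\<close>. A level \<open>u\<close> strictly below the transport cost is exceeded by
  the value of some pair, whence the bound at \<open>u\<close> by monotonicity.
\<close>

lemma cost_bound_if_log_laplace_le_conjugate: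
  assumes \<alpha>: "\<alpha> \<in> cost_class" and "\<Phi> \<subseteq> F \<times> F" and zero: "(\<lambda>_. 0, \<lambda>_. 0) \<in> \<Phi>"
    and \<nu>: "\<nu> \<in> prob_measures_integrating F"
    and le: "\<And>s \<psi> \<phi>. 0 \<le> s \<Longrightarrow> (\<psi>, \<phi>) \<in> \<Phi> \<Longrightarrow>
      ereal (log_laplace \<mu> \<psi> \<phi> s) \<le> monotone_conjugate \<alpha> s"
  shows "extend_at_infinity \<alpha> (transport_cost \<mu> \<Phi> \<nu>) \<le> relative_entropy \<nu> \<mu>"
proof (rule extend_at_infinity_le[OF \<alpha>])
  show "0 \<le> transport_cost \<mu> \<Phi> \<nu>"
    unfolding transport_cost_def using zero by (intro SUP_upper2[OF zero]) auto
  show "0 \<le> relative_entropy \<nu> \<mu>"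
    using entropy_duality_le[OF \<nu>, of "\<lambda>_. 0" 0 "\<lambda>_. 0"] F
    by (simp add: log_laplace_def \<mu>.prob_space function_space_def zero_ereal_def)
next
  fix u assume "0 \<le> u" and "ereal u < transport_cost \<mu> \<Phi> \<nu>"
  then obtain \<psi> \<phi> where \<Phi>: "(\<psi>, \<phi>) \<in> \<Phi>" and u: "u < (\<integral>x. \<psi> x \<partial>\<mu>) + (\<integral>x. \<phi> x \<partial>\<nu>)"
    by (auto simp: transport_cost_def less_SUP_iff)
  then have \<phi>: "\<phi> \<in> F"
    using \<open>\<Phi> \<subseteq> F \<times> F\<close> by auto
  define t where "t = (\<integral>x. \<psi> x \<partial>\<mu>) + (\<integral>x. \<phi> x \<partial>\<nu>)"
  have "\<alpha> u \<le> \<alpha> t"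
    using u \<open>0 \<le> u\<close> by (intro cost_class_mono[OF \<alpha>]) (auto simp: t_def)
  also have "\<alpha> t \<le> relative_entropy \<nu> \<mu>"
  proof (rule monotone_biconjugate[OF \<alpha>])
    show "0 \<le> t"
      using u \<open>0 \<le> u\<close> by (simp add: t_def)
    fix s :: real assume "0 \<le> s"
    have "ereal (s * t) - monotone_conjugate \<alpha> s \<le> ereal (s * t) - ereal (log_laplace \<mu> \<psi> \<phi> s)"
      by (intro ereal_minus_mono order_refl le \<open>0 \<le> s\<close> \<Phi>)
    also have "\<dots> \<le> relative_entropy \<nu> \<mu>"
      using entropy_duality_le[OF \<nu> \<phi>, of s \<psi>] by (simp add: t_def)
    finally show "ereal (s * t) - monotone_conjugate \<alpha> s \<le> relative_entropy \<nu> \<mu>" .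
  qed
  finally show "\<alpha> u \<le> relative_entropy \<nu> \<mu>" .
qed

lemma le_log_laplace_conjugate_if_log_laplace_le:
  assumes \<alpha>: "\<alpha> \<in> cost_class" and "0 \<le> t"
    and le: "\<And>s. 0 \<le> s \<Longrightarrow> ereal (log_laplace \<mu> \<psi> \<phi> s) \<le> monotone_conjugate \<alpha> s"
  shows "\<alpha> t \<le> log_laplace_conjugate \<mu> \<psi> \<phi> t"
proof (rule monotone_biconjugate[OF \<alpha> \<open>0 \<le> t\<close>])
  fix s :: real assume "0 \<le> s"
  have "ereal (s * t) - monotone_conjugate \<alpha> s \<le> ereal (s * t) - ereal (log_laplace \<mu> \<psi> \<phi> s)"
    by (intro ereal_minus_mono order_refl le \<open>0 \<le> s\<close>)
  also have "\<dots> \<le> log_laplace_conjugate \<mu> \<psi> \<phi> t"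
    unfolding log_laplace_conjugate_def by (auto intro: SUP_upper2)
  finally show "ereal (s * t) - monotone_conjugate \<alpha> s \<le> log_laplace_conjugate \<mu> \<psi> \<phi> t" .
qed

lemma log_laplace_le_if_le_log_laplace_conjugate:
  assumes \<alpha>: "\<alpha> \<in> cost_class" and \<phi>: "\<phi> \<in> F" and "0 \<le> s"
    and le: "\<And>t. 0 \<le> t \<Longrightarrow> \<alpha> t \<le> log_laplace_conjugate \<mu> \<psi> \<phi> t"
  shows "ereal (log_laplace \<mu> \<psi> \<phi> s) \<le> monotone_conjugate \<alpha> s"
  using le log_laplace_conjugate_le_entropy[OF _ \<phi>]
  by (intro log_laplace_le_conjugate_if_entropy_bound[OF \<alpha> \<phi> \<open>0 \<le> s\<close>]) (meson order_trans)

end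

section \<open>Deviations of the sample mean\<close>

definition sample_mean :: "(nat \<Rightarrow> 'b \<Rightarrow> 'a) \<Rightarrow> ('a \<Rightarrow> real) \<Rightarrow> nat \<Rightarrow> 'b \<Rightarrow> real" where
  "sample_mean X f n \<omega> = (\<Sum>i=1..n. f (X i \<omega>)) / real n"

text \<open>
  Presenting the empirical measure as an image measure shows that the set function in its definition
  is a measure, and makes its integrals finite sums.
\<close>

lemma empirical_measure_eq_distr:
  fixes X :: "nat \<Rightarrow> 'b \<Rightarrow> 'a::topological_space"
  assumes "1 \<le> n"
  shows "empirical_measure X n \<omega> = distr (uniform_count_measure {1..n}) borel (\<lambda>i. X i \<omega>)"
proof -
  let ?N = "distr (uniform_count_measure {1..n}) borel (\<lambda>i. X i \<omega>)"
  have m: "(\<lambda>i. X i \<omega>) \<in> uniform_count_measure {1..n} \<rightarrow>\<^sub>M borel"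
    by (simp add: measurable_cong_sets[OF sets_uniform_count_measure_count_space refl])
  have "empirical_measure X n \<omega> = measure_of UNIV (sets borel) (emeasure ?N)"
    unfolding empirical_measure_def
  proof (rule measure_of_eq)
    fix A assume "A \<in> sigma_sets UNIV (sets (borel :: 'a measure))"
    then have A: "A \<in> sets (borel :: 'a measure)"
      by (metis sets.sigma_sets_eq space_borel)
    let ?S = "{i \<in> {1..n}. X i \<omega> \<in> A}"
    have "emeasure ?N A = emeasure (uniform_count_measure {1..n}) ?S"
      unfolding emeasure_distr[OF m A]
      by (rule arg_cong2[where f = emeasure]) (auto simp: space_uniform_count_measure)
    also have "\<dots> = ennreal (real (card ?S) / real n)"
      using \<open>1 \<le> n\<close> by (subst emeasure_uniform_count_measure) (auto simp: ennreal_of_nat_eq_real_of_nat divide_ennreal)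
    also have "\<dots> = ennreal (1 / real n) * of_nat (card ?S)"
      by (simp add: ennreal_of_nat_eq_real_of_nat flip: ennreal_mult)
    also have "of_nat (card ?S) = (\<Sum>i=1..n. emeasure (return borel (X i \<omega>)) A)"
      using A by (simp add: indicator_def sum.If_cases Int_def)
    finally show "ennreal (1 / real n) * (\<Sum>i=1..n. emeasure (return borel (X i \<omega>)) A) = emeasure ?N A"
      by simp
  qed auto
  also have "\<dots> = ?N"
    using measure_of_of_measure[of ?N] by simp
  finally show ?thesis .
qed

lemma integral_empirical_measure:
  fixes X :: "nat \<Rightarrow> 'b \<Rightarrow> 'a::topological_space" and f :: "'a \<Rightarrow> real"
  assumes "1 \<le> n" and f: "f \<in> borel_measurable borel"
  shows "(\<integral>x. f x \<partial>empirical_measure X n \<omega>) = sample_mean X f n \<omega>"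
proof -
  have m: "(\<lambda>i. X i \<omega>) \<in> uniform_count_measure {1..n} \<rightarrow>\<^sub>M borel"
    by (simp add: measurable_cong_sets[OF sets_uniform_count_measure_count_space refl])
  show ?thesis
    unfolding empirical_measure_eq_distr[OF \<open>1 \<le> n\<close>] integral_distr[OF m f]
    by (simp add: integral_uniform_count_measure sample_mean_def)
qed

lemma ext_ln_rate_le_iff:
  assumes "0 \<le> p" "1 \<le> n"
  shows "ereal (1 / real n) * ext_ln p \<le> ereal r \<longleftrightarrow> p \<le> exp (real n * r)"
proof (cases "p = 0")
  case False
  have "ln p \<le> real n * r \<longleftrightarrow> p \<le> exp (real n * r)"
    using False assms(1) by (metis exp_le_cancel_iff exp_ln less_eq_real_def)
  then show ?thesis
    using False assms by (simp add: ext_ln_def field_simps)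
qed (use assms in \<open>simp add: ext_ln_def\<close>)

text \<open>
  A staircase dominating \<open>exp (N * s * y)\<close> whose expectation involves only tail probabilities at the
  grid points \<open>i * \<delta>\<close> and one further exponential moment. It covers \<open>y \<le> 0\<close> by the constant \<open>1\<close>, each grid cell by its value at the right
  end, and \<open>y \<ge> m * \<delta>\<close> by paying a further factor \<open>exp (N * (y - m * \<delta>)) \<ge> 1\<close>.
\<close>

lemma exp_le_staircase:
  fixes y N s \<delta> :: real
  assumes "0 \<le> N" "0 \<le> s" "0 < \<delta>"
  shows "exp (N * (s * y)) \<le> 1 + (\<Sum>i<m. exp (N * (s * (real (Suc i) * \<delta>))) * of_bool (real i * \<delta> \<le> y))
    + exp (- (N * (real m * \<delta>))) * exp (N * ((s + 1) * y))"
    (is "_ \<le> 1 + ?S + ?E")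
proof -
  have nonneg: "0 \<le> ?S" "0 \<le> ?E"
    by (auto intro!: sum_nonneg)
  consider "y \<le> 0" | "real m * \<delta> \<le> y" | "0 < y" "y < real m * \<delta>"
    by linarith
  then show ?thesis
  proof cases
    case 1
    then have "N * (s * y) \<le> 0"
      using assms by (simp add: mult_nonneg_nonpos)
    then have "exp (N * (s * y)) \<le> 1"
      by simp
    with nonneg show ?thesis by linarith
  next
    case 2
    have "N * (real m * \<delta>) \<le> N * y"
      by (intro mult_left_mono 2 assms)
    then have "exp (N * (s * y)) \<le> ?E"
      by (simp add: algebra_simps flip: exp_add)
    with nonneg show ?thesis by linarith
  next
    case 3
    define i where "i = nat \<lfloor>y / \<delta>\<rfloor>"
    have "real i = of_int \<lfloor>y / \<delta>\<rfloor>"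
      using 3 assms by (simp add: i_def)
    then have "real i \<le> y / \<delta>" "y / \<delta> < real i + 1"
      by linarith+
    then have i: "real i * \<delta> \<le> y" "y < real (Suc i) * \<delta>"
      using assms by (simp_all add: field_simps)
    then have "real i * \<delta> < real m * \<delta>"
      using 3 by linarith
    then have "i < m"
      using assms by simp
    have "exp (N * (s * y)) \<le> exp (N * (s * (real (Suc i) * \<delta>)))"
      using i assms by (intro exp_le_cancel_iff[THEN iffD2] mult_left_mono) auto
    also have "\<dots> = exp (N * (s * (real (Suc i) * \<delta>))) * of_bool (real i * \<delta> \<le> y)"
      using i by simp
    also have "\<dots> \<le> ?S"
      using \<open>i < m\<close> by (intro member_le_sum) auto
    finally show ?thesis
      using nonneg by linarith
  qed
qed

locale iid_sample = exp_integrable_functions \<mu> F + P: prob_space P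
  for \<mu> :: "'a::topological_space measure" and F :: "('a \<Rightarrow> real) set" and P :: "'b measure" +
  fixes X :: "nat \<Rightarrow> 'b \<Rightarrow> 'a"
  assumes indep: "P.indep_vars (\<lambda>_. borel) X {1..}"
    and law: "1 \<le> i \<Longrightarrow> distr P borel (X i) = \<mu>"
begin

lemma measurable_X [measurable (raw)]: "1 \<le> i \<Longrightarrow> X i \<in> P \<rightarrow>\<^sub>M borel"
  using indep by (auto simp: P.indep_vars_def)

lemma measurable_sample_mean [measurable (raw)]:
  "f \<in> borel_measurable borel \<Longrightarrow> sample_mean X f n \<in> borel_measurable P"
  unfolding sample_mean_def
  by (intro borel_measurable_divide borel_measurable_sum measurable_compose[OF measurable_X]) auto

lemma deviation_rate_le_iff:
  assumes "1 \<le> n" "\<phi> \<in> F"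
  shows "deviation_rate P X \<mu> \<psi> \<phi> t n \<le> ereal r \<longleftrightarrow>
    P.prob {\<omega> \<in> space P. t \<le> sample_mean X \<phi> n \<omega> + (\<integral>x. \<psi> x \<partial>\<mu>)} \<le> exp (real n * r)"
  using assms
  by (simp add: deviation_rate_def integral_empirical_measure measurable_F ext_ln_rate_le_iff)

lemma
  assumes "1 \<le> n" and \<phi>: "\<phi> \<in> F"
  shows integrable_exp_sample_mean:
      "integrable P (\<lambda>\<omega>. exp (real n * (s * (sample_mean X \<phi> n \<omega> + (\<integral>x. \<psi> x \<partial>\<mu>)))))" (is ?int)
    and expectation_exp_sample_mean:
      "P.expectation (\<lambda>\<omega>. exp (real n * (s * (sample_mean X \<phi> n \<omega> + (\<integral>x. \<psi> x \<partial>\<mu>)))))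
        = exp (real n * log_laplace \<mu> \<psi> \<phi> s)" (is ?eq)
proof -
  define q where "q x = exp (s * (\<phi> x + (\<integral>x. \<psi> x \<partial>\<mu>)))" for x
  have [measurable]: "q \<in> borel_measurable borel"
    unfolding q_def using \<phi> by measurable
  have q: "integrable \<mu> q" "(\<integral>x. q x \<partial>\<mu>) = exp (log_laplace \<mu> \<psi> \<phi> s)"
    using integrable_exp_scale[OF \<phi>] exp_log_laplace[OF \<phi>] by (auto simp: q_def[abs_def])
  have "P.indep_vars (\<lambda>_. borel) X {1..n}"
    using indep by (rule P.indep_vars_subset) auto
  then have ind: "P.indep_vars (\<lambda>_. borel) (\<lambda>i \<omega>. q (X i \<omega>)) {1..n}"
    by (rule P.indep_vars_compose2) simp
  have qX: "integrable P (\<lambda>\<omega>. q (X i \<omega>))" "P.expectation (\<lambda>\<omega>. q (X i \<omega>)) = (\<integral>x. q x \<partial>\<mu>)"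
    if "i \<in> {1..n}" for i
  proof -
    have "1 \<le> i"
      using that by simp
    note [measurable] = measurable_X[OF this]
    show "integrable P (\<lambda>\<omega>. q (X i \<omega>))"
      using q(1) integrable_distr_eq[of "X i" P borel q] by (simp add: law[OF \<open>1 \<le> i\<close>])
    show "P.expectation (\<lambda>\<omega>. q (X i \<omega>)) = (\<integral>x. q x \<partial>\<mu>)"
      using integral_distr[of "X i" P borel q] by (simp add: law[OF \<open>1 \<le> i\<close>])
  qed
  have prod: "(\<Prod>i=1..n. q (X i \<omega>)) = exp (real n * (s * (sample_mean X \<phi> n \<omega> + (\<integral>x. \<psi> x \<partial>\<mu>))))" for \<omega>
  proof -
    have n: "real n * sample_mean X \<phi> n \<omega> = (\<Sum>i=1..n. \<phi> (X i \<omega>))"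
      using \<open>1 \<le> n\<close> by (simp add: sample_mean_def)
    have "(\<Sum>i=1..n. s * (\<phi> (X i \<omega>) + (\<integral>x. \<psi> x \<partial>\<mu>)))
      = s * (real n * sample_mean X \<phi> n \<omega> + real n * (\<integral>x. \<psi> x \<partial>\<mu>))"
      unfolding n by (simp add: sum.distrib flip: sum_distrib_left)
    then show ?thesis
      by (simp add: q_def exp_sum[symmetric] distrib_left mult.left_commute)
  qed
  show ?int
    unfolding prod[symmetric] by (rule P.indep_vars_integrable[OF _ ind qX(1)]) auto
  show ?eq
    unfolding prod[symmetric]
    by (subst P.indep_vars_lebesgue_integral[OF _ ind qX(1)])
      (simp_all add: qX(2) q(2) exp_of_nat_mult)
qed

text \<open>
  Markov's inequality for the exponential of the sample mean. Only \<open>s \<ge> 0\<close> is admissible for an upper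
  tail, which is why the monotone conjugate is the relevant one.
\<close>

lemma Chernoff_bound:
  assumes "1 \<le> n" "\<phi> \<in> F" "0 \<le> s"
  shows "deviation_rate P X \<mu> \<psi> \<phi> t n \<le> ereal (log_laplace \<mu> \<psi> \<phi> s - s * t)"
proof -
  let ?Y = "\<lambda>\<omega>. sample_mean X \<phi> n \<omega> + (\<integral>x. \<psi> x \<partial>\<mu>)"
  have "P.prob {\<omega> \<in> space P. t \<le> ?Y \<omega>}
    \<le> P.prob {\<omega> \<in> space P. exp (real n * (s * t)) \<le> exp (real n * (s * ?Y \<omega>))}"
    using assms by (intro P.finite_measure_mono) (auto intro!: mult_left_mono)
  also have "\<dots> \<le> P.expectation (\<lambda>\<omega>. exp (real n * (s * ?Y \<omega>))) / exp (real n * (s * t))"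
    using assms
    by (intro integral_Markov_inequality_measure[where A = "{}"] integrable_exp_sample_mean) auto
  also have "\<dots> = exp (real n * (log_laplace \<mu> \<psi> \<phi> s - s * t))"
    using assms by (simp add: expectation_exp_sample_mean exp_diff right_diff_distrib)
  finally show ?thesis
    using assms by (simp add: deviation_rate_le_iff)
qed

lemma deviation_rate_le_if_log_laplace_le:
  assumes \<alpha>: "\<alpha> \<in> cost_class" and "1 \<le> n" "\<phi> \<in> F" "0 \<le> t"
    and le: "\<And>s. 0 \<le> s \<Longrightarrow> ereal (log_laplace \<mu> \<psi> \<phi> s) \<le> monotone_conjugate \<alpha> s"
  shows "deviation_rate P X \<mu> \<psi> \<phi> t n \<le> - \<alpha> t"
proof -
  have "\<alpha> t \<le> - deviation_rate P X \<mu> \<psi> \<phi> t n"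
  proof (rule monotone_biconjugate[OF \<alpha> \<open>0 \<le> t\<close>])
    fix s :: real assume "0 \<le> s"
    have "ereal (s * t) - monotone_conjugate \<alpha> s \<le> ereal (s * t) - ereal (log_laplace \<mu> \<psi> \<phi> s)"
      by (intro ereal_minus_mono order_refl le \<open>0 \<le> s\<close>)
    also have "\<dots> = - ereal (log_laplace \<mu> \<psi> \<phi> s - s * t)"
      by simp
    also have "\<dots> \<le> - deviation_rate P X \<mu> \<psi> \<phi> t n"
      using Chernoff_bound[OF assms(2,3) \<open>0 \<le> s\<close>] by (simp only: ereal_minus_le_minus)
    finally show "ereal (s * t) - monotone_conjugate \<alpha> s \<le> - deviation_rate P X \<mu> \<psi> \<phi> t n" .
  qed
  then have "- (- deviation_rate P X \<mu> \<psi> \<phi> t n) \<le> - \<alpha> t"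
    by (simp only: ereal_minus_le_minus)
  then show ?thesis
    by simp
qed

lemma exp_log_laplace_le_staircase:
  assumes "1 \<le> n" "\<phi> \<in> F" "0 \<le> s" "0 < \<delta>"
  shows "exp (real n * log_laplace \<mu> \<psi> \<phi> s) \<le> 1
    + (\<Sum>i<m. exp (real n * (s * (real (Suc i) * \<delta>))) *
        P.prob {\<omega> \<in> space P. real i * \<delta> \<le> sample_mean X \<phi> n \<omega> + (\<integral>x. \<psi> x \<partial>\<mu>)})
    + exp (- (real n * (real m * \<delta>))) * exp (real n * log_laplace \<mu> \<psi> \<phi> (s + 1))"
proof -
  define Y where "Y \<omega> = sample_mean X \<phi> n \<omega> + (\<integral>x. \<psi> x \<partial>\<mu>)" for \<omega>
  have [measurable]: "Y \<in> borel_measurable P"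
    unfolding Y_def using assms by measurable
  define A where "A i = {\<omega> \<in> space P. real i * \<delta> \<le> Y \<omega>}" for i
  have [measurable]: "A i \<in> sets P" for i
    unfolding A_def by measurable
  have E: "integrable P (\<lambda>\<omega>. exp (real n * (r * Y \<omega>)))"
    "P.expectation (\<lambda>\<omega>. exp (real n * (r * Y \<omega>))) = exp (real n * log_laplace \<mu> \<psi> \<phi> r)" for r
    unfolding Y_def using assms
    by (auto intro!: integrable_exp_sample_mean expectation_exp_sample_mean)
  have I: "integrable P (indicat_real (A i))" for i
    by (intro integrable_real_indicator) (auto simp: P.emeasure_eq_measure)
  have "exp (real n * log_laplace \<mu> \<psi> \<phi> s) = P.expectation (\<lambda>\<omega>. exp (real n * (s * Y \<omega>)))"
    by (simp add: E)
  also have "\<dots> \<le> P.expectation (\<lambda>\<omega>. 1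
    + (\<Sum>i<m. exp (real n * (s * (real (Suc i) * \<delta>))) * indicat_real (A i) \<omega>)
    + exp (- (real n * (real m * \<delta>))) * exp (real n * ((s + 1) * Y \<omega>)))"
  proof (rule integral_mono)
    fix \<omega> assume "\<omega> \<in> space P"
    then have "indicat_real (A i) \<omega> = of_bool (real i * \<delta> \<le> Y \<omega>)" for i
      by (simp add: A_def indicator_def)
    then show "exp (real n * (s * Y \<omega>)) \<le> 1
      + (\<Sum>i<m. exp (real n * (s * (real (Suc i) * \<delta>))) * indicat_real (A i) \<omega>)
      + exp (- (real n * (real m * \<delta>))) * exp (real n * ((s + 1) * Y \<omega>))"
      using exp_le_staircase[of "real n" s \<delta> "Y \<omega>" m] assms by simp
  qed (intro Bochner_Integration.integrable_add Bochner_Integration.integrable_sum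
      integrable_mult_right I E | simp)+
  also have "\<dots> = 1 + (\<Sum>i<m. exp (real n * (s * (real (Suc i) * \<delta>))) * P.prob (A i))
    + exp (- (real n * (real m * \<delta>))) * exp (real n * log_laplace \<mu> \<psi> \<phi> (s + 1))"
    using I E by (simp add: P.prob_space del: of_nat_Suc sum_mult_indicator)
  finally show ?thesis
    by (simp add: A_def Y_def)
qed

text \<open>
  Suppose \<open>\<alpha>\<^sup>\<circledast> s < B < \<Lambda> s\<close>. At each point \<open>t\<close> of a finite grid the tail probability is eventually at
  most \<open>exp (n * (B - s * t))\<close>, because \<open>- \<alpha> t < B - s * t\<close>. Then every term of the staircase bound for
  \<open>exp (n * \<Lambda> s)\<close> has an exponential rate strictly smaller than \<open>\<Lambda> s\<close>, which is impossible for
  large \<open>n\<close>.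
\<close>

lemma log_laplace_le_if_limsup_le:
  assumes \<alpha>: "\<alpha> \<in> cost_class" and \<phi>: "\<phi> \<in> F" and "0 \<le> s"
    and lim: "\<And>t. 0 \<le> t \<Longrightarrow> limsup (deviation_rate P X \<mu> \<psi> \<phi> t) \<le> - \<alpha> t"
  shows "ereal (log_laplace \<mu> \<psi> \<phi> s) \<le> monotone_conjugate \<alpha> s"
proof (rule ccontr)
  define L where "L = log_laplace \<mu> \<psi> \<phi> s"
  define L' where "L' = log_laplace \<mu> \<psi> \<phi> (s + 1)"
  assume "\<not> ?thesis"
  then have "monotone_conjugate \<alpha> s < ereal L"
    by (simp add: L_def)
  then obtain B where B: "monotone_conjugate \<alpha> s < ereal B" "B < L"
    using ereal_dense2 by force
  have "0 < B"
    using B(1) monotone_conjugate_nonneg[OF \<alpha>, of s] by (metis ereal_less(2) order_le_less_trans)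
  \<comment> \<open>The mesh is so fine that rounding up inside a cell, which costs \<open>s * \<delta>\<close>, does not use up the gap
    between \<open>B\<close> and \<open>L\<close>.\<close>
  define \<delta> where "\<delta> = (L - B) / (2 * (s + 1))"
  have "0 < \<delta>"
    using B(2) \<open>0 \<le> s\<close> by (simp add: \<delta>_def)
  have "\<delta> * (2 * (s + 1)) = L - B"
    using \<open>0 \<le> s\<close> by (simp add: \<delta>_def)
  then have "2 * (s * \<delta>) + 2 * \<delta> = L - B"
    by (simp add: algebra_simps)
  then have \<delta>: "s * \<delta> + B < L"
    using \<open>0 < \<delta>\<close> mult_nonneg_nonneg[of s \<delta>] \<open>0 \<le> s\<close> by linarith
  \<comment> \<open>The grid is so long that the values beyond it, which contribute with rate \<open>L' - m * \<delta>\<close>, are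
    negligible against \<open>exp (n * L)\<close>.\<close>
  obtain m :: nat where "(L' - L) / \<delta> < real m"
    using reals_Archimedean2 by blast
  then have m: "L' - real m * \<delta> < L"
    using \<open>0 < \<delta>\<close> by (simp add: field_simps)
  have ev: "eventually (\<lambda>n. P.prob {\<omega> \<in> space P. real i * \<delta> \<le> sample_mean X \<phi> n \<omega> + (\<integral>x. \<psi> x \<partial>\<mu>)}
      \<le> exp (real n * (B - s * (real i * \<delta>)))) sequentially" for i
  proof -
    have i: "0 \<le> real i * \<delta>"
      using \<open>0 < \<delta>\<close> by simp
    have "ereal (s * (real i * \<delta>)) - \<alpha> (real i * \<delta>) < ereal B"
      using monotone_conjugate_upper[OF i, of s \<alpha>] B(1) by order
    then have "- \<alpha> (real i * \<delta>) < ereal (B - s * (real i * \<delta>))"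
      by (cases "\<alpha> (real i * \<delta>)") auto
    then have "limsup (deviation_rate P X \<mu> \<psi> \<phi> (real i * \<delta>)) < ereal (B - s * (real i * \<delta>))"
      using lim[OF i] by order
    from Limsup_lessD[OF this] eventually_ge_at_top[of 1] show ?thesis
      by eventually_elim (auto simp: deviation_rate_le_iff[OF _ \<phi>] dest: less_imp_le)
  qed
  \<comment> \<open>The staircase bound divided by \<open>exp (n * L)\<close>.\<close>
  define R where "R n = exp (- (real n * L)) + real m * exp (- (real n * (L - (s * \<delta> + B))))
    + exp (- (real n * (L - (L' - real m * \<delta>))))" for n
  have "eventually (\<lambda>n. \<forall>i\<in>{..<m}. P.prob {\<omega> \<in> space P. real i * \<delta> \<le> sample_mean X \<phi> n \<omega> + (\<integral>x. \<psi> x \<partial>\<mu>)}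
      \<le> exp (real n * (B - s * (real i * \<delta>)))) sequentially"
    by (intro eventually_ball_finite ballI ev) simp
  then have "eventually (\<lambda>n. 1 \<le> R n) sequentially"
    using eventually_ge_at_top[of 1]
  proof eventually_elim
    case (elim n)
    have "(\<Sum>i<m. exp (real n * (s * (real (Suc i) * \<delta>))) *
        P.prob {\<omega> \<in> space P. real i * \<delta> \<le> sample_mean X \<phi> n \<omega> + (\<integral>x. \<psi> x \<partial>\<mu>)})
      \<le> (\<Sum>i<m. exp (real n * (s * (real (Suc i) * \<delta>))) * exp (real n * (B - s * (real i * \<delta>))))"
      using elim by (intro sum_mono mult_left_mono) auto
    also have "\<dots> = real m * exp (real n * (s * \<delta> + B))"
      by (simp add: algebra_simps flip: exp_add)
    finally have "exp (real n * L) \<le> 1 + real m * exp (real n * (s * \<delta> + B))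
      + exp (- (real n * (real m * \<delta>))) * exp (real n * L')"
      using exp_log_laplace_le_staircase[OF elim(2) \<phi> \<open>0 \<le> s\<close> \<open>0 < \<delta>\<close>, of \<psi> m]
      unfolding L_def L'_def by linarith
    then have "exp (- (real n * L)) * exp (real n * L) \<le> exp (- (real n * L)) *
      (1 + real m * exp (real n * (s * \<delta> + B)) + exp (- (real n * (real m * \<delta>))) * exp (real n * L'))"
      by (intro mult_left_mono) auto
    also have "\<dots> = R n"
      by (simp add: R_def algebra_simps flip: exp_add)
    finally show ?case
      by (simp flip: exp_add)
  qed
  moreover have "R \<longlonglongrightarrow> 0"
  proof -
    have decay: "(\<lambda>n. exp (- (real n * a))) \<longlonglongrightarrow> 0" if "0 < a" for a :: real
      using LIMSEQ_power_zero[of "exp (- a)"] that by (simp flip: exp_of_nat_mult)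
    have "R \<longlonglongrightarrow> 0 + real m * 0 + 0"
      unfolding R_def using \<open>0 < B\<close> B(2) \<delta> m
      by (intro tendsto_add tendsto_mult tendsto_const decay) auto
    then show ?thesis by simp
  qed
  ultimately have "(1::real) \<le> 0"
    by (intro tendsto_lowerbound[of R 0 sequentially 1]) auto
  then show False by simp
qed

end

section \<open>Equivalence of the five statements\<close>

theorem theorem3p7:
  fixes \<mu> :: "'a::polish_space measure"
    and F :: "('a \<Rightarrow> real) set"
    and \<Phi> :: "(('a \<Rightarrow> real) \<times> ('a \<Rightarrow> real)) set"
    and \<alpha> :: "real \<Rightarrow> ereal"
    and P :: "'b measure"
    and X :: "nat \<Rightarrow> 'b \<Rightarrow> 'a"
    and a b c d e :: bool
  assumes "\<mu> \<in> borel_prob_measures"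
    and "function_space F"
    and "F \<subseteq> borel_measurable borel"
    and "\<And>\<phi>. \<phi> \<in> F \<Longrightarrow> integrable \<mu> (\<lambda>x. exp (\<phi> x))"
    and "(\<lambda>_. 0, \<lambda>_. 0) \<in> \<Phi>"
    and "\<Phi> \<subseteq> F \<times> F"
    and "\<alpha> \<in> cost_class"
    and "prob_space P"
    and "prob_space.indep_vars P (\<lambda>_. borel) X {1..}"
    and "\<And>i. i \<ge> 1 \<Longrightarrow> distr P borel (X i) = \<mu>"
    and a: "a \<longleftrightarrow> (\<forall>\<nu>\<in>prob_measures_integrating F.
              extend_at_infinity \<alpha> (transport_cost \<mu> \<Phi> \<nu>) \<le> relative_entropy \<nu> \<mu>)"
    and b: "b \<longleftrightarrow> (\<forall>s\<ge>0. \<forall>(\<psi>, \<phi>)\<in>\<Phi>.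
              ereal (log_laplace \<mu> \<psi> \<phi> s) \<le> monotone_conjugate \<alpha> s)"
    and c: "c \<longleftrightarrow> (\<forall>t\<ge>0. \<forall>(\<psi>, \<phi>)\<in>\<Phi>.
              \<alpha> t \<le> log_laplace_conjugate \<mu> \<psi> \<phi> t)"
    and d: "d \<longleftrightarrow> (\<forall>t\<ge>0. \<forall>(\<psi>, \<phi>)\<in>\<Phi>.
              limsup (deviation_rate P X \<mu> \<psi> \<phi> t) \<le> - \<alpha> t)"
    and e: "e \<longleftrightarrow> (\<forall>n\<ge>1. \<forall>t\<ge>0. \<forall>(\<psi>, \<phi>)\<in>\<Phi>.
              deviation_rate P X \<mu> \<psi> \<phi> t n \<le> - \<alpha> t)"
  shows "(a \<longleftrightarrow> b) \<and> (b \<longleftrightarrow> c) \<and> (e \<longrightarrow> d) \<and> (d \<longrightarrow> a) \<and>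
         ((\<forall>(\<psi>, \<phi>)\<in>\<Phi>. (\<integral>x. \<phi> x + \<psi> x \<partial>\<mu>) \<le> 0) \<longrightarrow>
            (a \<longleftrightarrow> b) \<and> (b \<longleftrightarrow> c) \<and> (c \<longleftrightarrow> d) \<and> (d \<longleftrightarrow> e))"
proof -
  have P: "prob_space P"
    using assms(8) .
  interpret iid_sample \<mu> F P X
    using assms(1-4,9,10)
    by (intro iid_sample.intro iid_sample_axioms.intro exp_integrable_functions.intro P) auto
  note \<alpha> = \<open>\<alpha> \<in> cost_class\<close>
  have \<Phi>_F: "\<phi> \<in> F" if "(\<psi>, \<phi>) \<in> \<Phi>" for \<psi> \<phi>
    using that \<open>\<Phi> \<subseteq> F \<times> F\<close> by auto
  have "a \<Longrightarrow> b"
    unfolding a b using log_laplace_le_conjugate_if_cost_bound[OF \<alpha> \<open>\<Phi> \<subseteq> F \<times> F\<close>] by blast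
  moreover have "b \<Longrightarrow> a"
    unfolding a b
    using cost_bound_if_log_laplace_le_conjugate[OF \<alpha> \<open>\<Phi> \<subseteq> F \<times> F\<close> \<open>(\<lambda>_. 0, \<lambda>_. 0) \<in> \<Phi>\<close>] by blast
  moreover have "b \<Longrightarrow> c"
    unfolding b c using le_log_laplace_conjugate_if_log_laplace_le[OF \<alpha>] by blast
  moreover have "c \<Longrightarrow> b"
    unfolding b c using log_laplace_le_if_le_log_laplace_conjugate[OF \<alpha> \<Phi>_F] by blast
  moreover have "b \<Longrightarrow> e"
    unfolding b e using deviation_rate_le_if_log_laplace_le[OF \<alpha> _ \<Phi>_F] by blast
  moreover have "d" if e
    unfolding d
  proof (safe)
    fix t :: real and \<psi> \<phi> assume "0 \<le> t" "(\<psi>, \<phi>) \<in> \<Phi>"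
    then have "eventually (\<lambda>n. deviation_rate P X \<mu> \<psi> \<phi> t n \<le> - \<alpha> t) sequentially"
      using that unfolding e by (intro eventually_sequentiallyI[of 1]) fastforce
    then show "limsup (deviation_rate P X \<mu> \<psi> \<phi> t) \<le> - \<alpha> t"
      by (rule Limsup_bounded)
  qed
  moreover have "d \<Longrightarrow> b"
    unfolding b d using log_laplace_le_if_limsup_le[OF \<alpha> \<Phi>_F] by blast
  ultimately show ?thesis
    by blast
qed

end
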